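(* Let $0<|q|<1$. Then \begin{align*} \sum_{i,j,k=0}^{\infty}\frac{(-1)^{j}q^{2\binom{i+j+3k}{2}+6\binom k2+2i+3j+12k}}{(q;q)_i(q;q)_{j}(q^6;q^6)_k}&=\frac{(q^4,q^{20};q^{24})_\infty}{(q^2;q^{4})_\infty},\\ \sum_{i,j,k=0}^{\infty}\frac{(-1)^{j+k}q^{2\binom{i+j+3k}{2}+6\binom k2+i+j+6k}}{(q;q)_{i}(-q;-q)_j(q^6;q^6)_k}&=\frac{1}{(q^2;q^4)_\infty(q^2,q^{10};q^{12})_\infty}, \\ \sum_{i,j,k=0}^{\infty}\frac{(-1)^{j+k}q^{2\binom{i+j+3k}{2}+6\binom k2+2i+3j+12k}}{(q;q)_i(-q;-q)_{j}(q^6;q^6)_k}&=\frac{1}{(q^2;q^{4})_\infty(q^4,q^8;q^{12})_\infty}. \end{align*}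
   Context: Notation: $(a;p)_n=\prod_{m=0}^{n-1}(1-ap^m)$ for any base $p$ (here $p$ may be $q$, $-q$, $q^4$, etc.; $n=\infty$ allowed), and $(a_1,\dots,a_m;p)_n=(a_1;p)_n\cdots(a_m;p)_n$. *)

theory Defs
  imports "HOL-Analysis.Analysis"
begin

definition qpoch :: "complex \<Rightarrow> complex \<Rightarrow> nat \<Rightarrow> complex" where
  "qpoch a p n = (\<Prod>m<n. 1 - a * p ^ m)"

definition qpoch_inf :: "complex \<Rightarrow> complex \<Rightarrow> complex" where
  "qpoch_inf a p = (\<Prod>m. 1 - a * p ^ m)"

text \<open>The infinite product is only meaningful where it converges; this covers every base
  of modulus less than one (a vanishing factor is allowed and gives the value zero).\<close>

lemma has_prod_qpoch_inf:
  assumes "norm p < 1"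
  shows "(\<lambda>m. 1 - a * p ^ m) has_prod qpoch_inf a p"
proof -
  have "summable (\<lambda>m. norm a * norm p ^ m)"
    using assms by (intro summable_mult summable_geometric) simp
  then have "abs_convergent_prod (\<lambda>m. 1 - a * p ^ m)"
    by (simp add: abs_convergent_prod_conv_summable norm_mult norm_power)
  then have "convergent_prod (\<lambda>m. 1 - a * p ^ m)"
    by (rule abs_convergent_prod_imp_convergent_prod)
  then show ?thesis
    unfolding qpoch_inf_def by (rule convergent_prod_has_prod)
qed

text \<open>The multi-parameter symbol $(a_1, \dots, a_m; p)_\infty$.\<close>

definition qpochs_inf :: "complex list \<Rightarrow> complex \<Rightarrow> complex" where
  "qpochs_inf as p = (\<Prod>a\<leftarrow>as. qpoch_inf a p)"

end

theory Submission
  imports Defs "HOL-Computational_Algebra.Formal_Laurent_Series"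
begin

text \<open>Put $p = q^2$ and group the terms by $n = i + j + 3k$: each sum becomes
  $\sum_n p^{n(n-1)/2} F_n$, where $F$ is a product of three Euler series in $X$. In all three
  cases the infinite products collapse to
  $F = (uX, vX; p)_\infty / ((pX; p)_\infty (uvX^2/p; p^2)_\infty)$, with $v/u$ a primitive cube
  root of unity. The coefficients of $(uX, vX; p)_\infty / (uvX^2/p; p^2)_\infty$ are
  $(-p; p)_N\, p^{-N(N-1)/2} \sigma_N$, where $\sum_N \sigma_N X^N = (uX, vX; p^2)_\infty$. The weight
  $p^{n(n-1)/2}$ cancels the negative power of $p$, and by Euler's theorem the sum over the
  coefficients of $1/(pX; p)_\infty$ contributes $(-p^{N+1}; p)_\infty$, which completes
  $(-p; p)_N$ to $(-p; p)_\infty = 1/(p; p^2)_\infty$. Hence the sum equals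
  $(u, v; p^2)_\infty / (p; p^2)_\infty$. All identities between formal series are checked through
  their $X \mapsto pX$ functional equations, whose solutions are unique because $p^n \neq 1$.\<close>

section \<open>Triangular exponents and basic properties of \<open>qpoch\<close> and
  \<open>qpoch_inf\<close>\<close>

lemma Suc_choose_two: "Suc n choose 2 = (n choose 2) + n"
  by (simp add: numeral_2_eq_2)

lemma add_choose_two: "(m + n) choose 2 = (m choose 2) + (n choose 2) + m * n"
  by (induction n) (simp_all add: Suc_choose_two)

lemma qpoch_0 [simp]: "qpoch a p 0 = 1"
  by (simp add: qpoch_def)

lemma qpoch_Suc: "qpoch a p (Suc n) = qpoch a p n * (1 - a * p ^ n)"
  by (simp add: qpoch_def)

lemma one_minus_nonzero: "1 - z \<noteq> 0" if "norm z < 1" for z :: complex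
  using that by auto

lemma norm_mult_power_less_1: "norm (a * p ^ n) < 1"
  if "norm a < 1" "norm p < 1" for a p :: complex
proof -
  have "norm a * norm p ^ n \<le> norm a * 1"
    using that by (intro mult_left_mono power_le_one) auto
  then show ?thesis
    using that by (simp add: norm_mult norm_power)
qed

lemma norm_power_less_1: "norm (p ^ k) < 1" if "norm p < 1" "k > 0" for p :: complex
  using that by (simp add: norm_power power_less_one_iff)

lemma qpoch_nonzero: "qpoch a p n \<noteq> 0" if "norm a < 1" "norm p < 1"
  using one_minus_nonzero[OF norm_mult_power_less_1[OF that]] by (simp add: qpoch_def)

lemma qpoch_tendsto: "(\<lambda>n. qpoch a p n) \<longlonglongrightarrow> qpoch_inf a p" if "norm p < 1"
  using has_prod_imp_tendsto'[OF has_prod_qpoch_inf[OF that]] by (simp add: qpoch_def)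

lemma qpoch_inf_nonzero: "qpoch_inf a p \<noteq> 0" if "norm a < 1" "norm p < 1"
  using has_prod_eq_0_iff[OF has_prod_qpoch_inf[OF that(2), of a]]
    one_minus_nonzero[OF norm_mult_power_less_1[OF that]] by force

lemma qpoch_add: "qpoch a p (m + n) = qpoch a p m * qpoch (a * p ^ m) p n"
  by (induction n) (simp_all add: qpoch_Suc power_add mult_ac)

text \<open>Let n tend to infinity in \<open>qpoch_add\<close>. Its later use is to join
  \<open>qpoch (- p) p N\<close> with the tail (-p^(N+1); p)_\<infinity> into a product independent
  of N.\<close>

lemma qpoch_inf_split: "qpoch_inf a p = qpoch a p m * qpoch_inf (a * p ^ m) p" if "norm p < 1"
proof (rule LIMSEQ_unique)
  show "(\<lambda>n. qpoch a p (m + n)) \<longlonglongrightarrow> qpoch_inf a p"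
    using LIMSEQ_ignore_initial_segment[OF qpoch_tendsto[OF that], of a m] by (simp add: add.commute)
  show "(\<lambda>n. qpoch a p (m + n)) \<longlonglongrightarrow> qpoch a p m * qpoch_inf (a * p ^ m) p"
    unfolding qpoch_add by (intro tendsto_mult tendsto_const qpoch_tendsto that)
qed

section \<open>Product identities: multisection, roots of unity, Euler's theorem\<close>

text \<open>The partial products along the subsequence k n have the limit of the full sequence, so
  an identity of finite products passes to the limit although its two sides advance at different
  speeds.\<close>

lemma qpoch_inf_cong_prod:
  assumes "norm p < 1" and "\<And>n. qpoch a p (k * n) = (\<Prod>i\<in>I. qpoch (b i) r n)"
    and "k > 0" "norm r < 1"
  shows "qpoch_inf a p = (\<Prod>i\<in>I. qpoch_inf (b i) r)"
proof (rule LIMSEQ_unique)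
  have "filterlim (\<lambda>n. k * n) at_top sequentially"
    using \<open>k > 0\<close> by (intro filterlim_subseq strict_monoI) simp
  then show "(\<lambda>n. qpoch a p (k * n)) \<longlonglongrightarrow> qpoch_inf a p"
    using filterlim_compose[OF qpoch_tendsto[OF assms(1)]] by blast
  show "(\<lambda>n. qpoch a p (k * n)) \<longlonglongrightarrow> (\<Prod>i\<in>I. qpoch_inf (b i) r)"
    unfolding assms(2) by (intro tendsto_prod qpoch_tendsto assms)
qed

text \<open>The factors 1 - a p^m are sorted by m mod k: each block of k consecutive factors
  contributes one factor to each product on the right.\<close>

lemma qpoch_inf_multisect:
  assumes "norm p < 1" "k > 0"
  shows "qpoch_inf a p = (\<Prod>i<k. qpoch_inf (a * p ^ i) (p ^ k))"
proof (rule qpoch_inf_cong_prod[where k = k])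
  show "norm (p ^ k) < 1"
    using assms by (rule norm_power_less_1)
  show "qpoch a p (k * n) = (\<Prod>i<k. qpoch (a * p ^ i) (p ^ k) n)" for n
  proof (induction n)
    case (Suc n)
    have "qpoch a p (k * Suc n) = qpoch a p (k * n) * qpoch (a * p ^ (k * n)) p k"
      by (subst qpoch_add[symmetric]) (simp add: add.commute)
    also have "\<dots> = (\<Prod>i<k. qpoch (a * p ^ i) (p ^ k) (Suc n))"
      unfolding Suc by (simp add: qpoch_Suc prod.distrib)
        (simp add: qpoch_def power_mult mult_ac)
    finally show ?case .
  qed simp
qed (use assms in auto)

lemma qpoch_inf_bisect: "qpoch_inf a p = qpoch_inf a (p ^ 2) * qpoch_inf (a * p) (p ^ 2)"
  if "norm p < 1"
  using qpoch_inf_multisect[OF that, of 2 a] by (simp add: numeral_2_eq_2)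

lemma qpoch_inf_trisect:
  "qpoch_inf a p = qpoch_inf a (p ^ 3) * qpoch_inf (a * p) (p ^ 3) * qpoch_inf (a * p ^ 2) (p ^ 3)"
  if "norm p < 1"
  using qpoch_inf_multisect[OF that, of 3 a] by (simp add: numeral_3_eq_3 numeral_2_eq_2 mult_ac)

text \<open>Factorwise this is (1 - x)(1 + x) = 1 - x^2 with x = a p^m.\<close>

lemma qpoch_inf_plus_minus: "qpoch_inf a p * qpoch_inf (- a) p = qpoch_inf (a ^ 2) (p ^ 2)"
  if "norm p < 1"
proof (rule LIMSEQ_unique)
  show "(\<lambda>n. qpoch a p n * qpoch (- a) p n) \<longlonglongrightarrow> qpoch_inf a p * qpoch_inf (- a) p"
    by (intro tendsto_mult qpoch_tendsto that)
  have "qpoch a p n * qpoch (- a) p n = qpoch (a ^ 2) (p ^ 2) n" for n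
    by (induction n) (simp_all add: qpoch_Suc, simp add: algebra_simps power2_eq_square power_mult_distrib)
  then show "(\<lambda>n. qpoch a p n * qpoch (- a) p n) \<longlonglongrightarrow> qpoch_inf (a ^ 2) (p ^ 2)"
    using qpoch_tendsto[OF norm_power_less_1[OF that]] by simp
qed

text \<open>The hypotheses make w and w' the roots of t^2 + t + 1, that is, the two primitive cube
  roots of unity, so each triple of factors multiplies to 1 - x^3.\<close>

lemma qpoch_inf_cube_roots:
  assumes "norm p < 1" "w + w' = -1" "w * w' = 1"
  shows "qpoch_inf a p * qpoch_inf (w * a) p * qpoch_inf (w' * a) p = qpoch_inf (a ^ 3) (p ^ 3)"
proof (rule LIMSEQ_unique)
  show "(\<lambda>n. qpoch a p n * qpoch (w * a) p n * qpoch (w' * a) p n)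
      \<longlonglongrightarrow> qpoch_inf a p * qpoch_inf (w * a) p * qpoch_inf (w' * a) p"
    by (intro tendsto_mult qpoch_tendsto assms)
  have *: "(1 - x) * (1 - w * x) * (1 - w' * x) = 1 - x ^ 3" for x
    using assms(2,3) by algebra
  have "qpoch a p n * qpoch (w * a) p n * qpoch (w' * a) p n = qpoch (a ^ 3) (p ^ 3) n" for n
  proof (induction n)
    case (Suc n)
    show ?case
      using Suc *[of "a * p ^ n"]
      by (simp add: qpoch_Suc power_mult_distrib mult_ac flip: power_mult)
  qed simp
  then show "(\<lambda>n. qpoch a p n * qpoch (w * a) p n * qpoch (w' * a) p n) \<longlonglongrightarrow> qpoch_inf (a ^ 3) (p ^ 3)"
    using qpoch_tendsto[OF norm_power_less_1[OF assms(1)]] by simp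
qed

text \<open>By (p; p)_\<infinity> (-p; p)_\<infinity> = (p^2; p^2)_\<infinity> and (p;
  p)_\<infinity> = (p; p^2)_\<infinity> (p^2; p^2)_\<infinity>; the nonzero factor (p^2;
  p^2)_\<infinity> cancels.\<close>

lemma qpoch_inf_euler: "qpoch_inf (- p) p * qpoch_inf p (p ^ 2) = 1" if "norm p < 1"
proof -
  have "qpoch_inf (p ^ 2) (p ^ 2) * (qpoch_inf (- p) p * qpoch_inf p (p ^ 2)) = qpoch_inf (p ^ 2) (p ^ 2)"
    using qpoch_inf_plus_minus[OF that, of p] qpoch_inf_bisect[OF that, of p]
    by (simp add: power2_eq_square mult_ac)
  then show ?thesis
    using qpoch_inf_nonzero[of "p ^ 2" "p ^ 2"] that norm_power_less_1[OF that, of 2] by simp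
qed

section \<open>Bounds for \<open>qpoch\<close> and Euler's expansion of (a; p)_\<infinity>\<close>

text \<open>The limit \<open>qpoch_inf a p\<close> is nonzero, so the reciprocals converge and are
  therefore bounded.\<close>

lemma inverse_qpoch_bounded:
  assumes "norm a < 1" "norm p < 1"
  obtains M where "M > 0" "\<And>n. norm (1 / qpoch a p n) \<le> M"
proof -
  have "(\<lambda>n. 1 / qpoch a p n) \<longlonglongrightarrow> 1 / qpoch_inf a p"
    by (intro tendsto_divide tendsto_const qpoch_tendsto qpoch_inf_nonzero assms)
  then have "Bseq (\<lambda>n. 1 / qpoch a p n)"
    using convergentI Bseq_eq_bounded convergent_imp_Bseq by blast
  then show ?thesis
    using that unfolding Bseq_def by blast
qed

lemma qpoch_bounded:
  assumes "norm p < 1"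
  obtains M where "M > 0" "\<And>n. norm (qpoch a p n) \<le> M"
  using convergent_imp_Bseq[OF convergentI[OF qpoch_tendsto[OF assms, of a]]] that
  unfolding Bseq_def by blast

lemma euler_abs_summable:
  assumes "norm a < 1" "norm p < 1"
  shows "(\<lambda>n. norm ((- a) ^ n * p ^ (n choose 2) / qpoch p p n)) summable_on UNIV"
proof -
  obtain M where M: "M > 0" "\<And>n. norm (1 / qpoch p p n) \<le> M"
    using inverse_qpoch_bounded[OF assms(2,2)] by blast
  have "(\<lambda>n. M * norm a ^ n) summable_on UNIV"
    using assms M by (subst summable_on_UNIV_nonneg_real_iff) (auto intro!: summable_mult summable_geometric)
  moreover have "norm ((- a) ^ n * p ^ (n choose 2) / qpoch p p n) \<le> M * norm a ^ n" for n
  proof -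
    have "norm ((- a) ^ n * p ^ (n choose 2) / qpoch p p n)
        = norm (1 / qpoch p p n) * (norm p ^ (n choose 2)) * norm a ^ n"
      by (simp add: norm_mult norm_divide norm_power)
    also have "\<dots> \<le> M * 1 * norm a ^ n"
      using assms M less_imp_le by (intro mult_right_mono mult_mono power_le_one) auto
    finally show ?thesis by simp
  qed
  ultimately show ?thesis
    by (rule Infinite_Sum.abs_summable_on_comparison_test')
qed

text \<open>The power series \<phi> satisfies \<phi>(x) = (1 - x) \<phi>(x p). Iteration gives
  \<phi>(a) = (a; p)_n \<phi>(a p^n), and continuity at 0 together with \<phi>(0) = 1 yields the
  limit.\<close>

lemma euler_has_sum:
  assumes a: "norm a < 1" and p: "norm p < 1"
  shows "((\<lambda>n. (- a) ^ n * p ^ (n choose 2) / qpoch p p n) has_sum qpoch_inf a p) UNIV"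
proof -
  define c where "c = (\<lambda>n. (- 1) ^ n * p ^ (n choose 2) / qpoch p p n)"
  define \<phi> where "\<phi> = (\<lambda>x. \<Sum>n. c n * x ^ n)"
  have term_eq: "(- x) ^ n * p ^ (n choose 2) / qpoch p p n = c n * x ^ n" for x n
    by (simp add: c_def power_minus[of x])
  have sm: "summable (\<lambda>n. c n * x ^ n)" if "norm x < 1" for x
    using euler_abs_summable[OF that p, THEN abs_summable_summable]
    unfolding term_eq by (rule summable_on_imp_summable)
  \<comment> \<open>This is the functional equation of \<phi> on the level of coefficients; the
    factor p^n is the increment of the triangular exponent.\<close>
  have rec: "c (Suc n) * (1 - p ^ Suc n) = - (p ^ n) * c n" for n
  proof -
    have "1 - p * p ^ n \<noteq> 0" "qpoch p p n \<noteq> 0"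
      using one_minus_nonzero[OF norm_mult_power_less_1[OF p p]] qpoch_nonzero[OF p p] by auto
    then show ?thesis
      by (simp add: c_def qpoch_Suc Suc_choose_two power_add field_simps)
  qed
  have fe: "\<phi> x = (1 - x) * \<phi> (x * p)" if x: "norm x < 1" for x
  proof -
    have xp: "norm (x * p) < 1"
      using norm_mult_power_less_1[OF x p, of 1] by simp
    have s1: "(\<lambda>n. c n * x ^ n - c n * (x * p) ^ n) sums (\<phi> x - \<phi> (x * p))"
      unfolding \<phi>_def by (intro sums_diff summable_sums sm x xp)
    \<comment> \<open>The index can be shifted because the two constant terms cancel.\<close>
    have "(\<lambda>n. c (Suc n) * x ^ Suc n - c (Suc n) * (x * p) ^ Suc n) sums (\<phi> x - \<phi> (x * p))"
      using s1 by (subst sums_Suc_iff) simp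
    moreover have "c (Suc n) * x ^ Suc n - c (Suc n) * (x * p) ^ Suc n = - x * (c n * (x * p) ^ n)" for n
    proof -
      have "c (Suc n) * x ^ Suc n - c (Suc n) * (x * p) ^ Suc n
          = (c (Suc n) * (1 - p ^ Suc n)) * x ^ Suc n"
        by (simp add: power_mult_distrib algebra_simps)
      then show ?thesis
        unfolding rec by (simp add: power_mult_distrib)
    qed
    ultimately have "(\<lambda>n. - x * (c n * (x * p) ^ n)) sums (\<phi> x - \<phi> (x * p))"
      by simp
    moreover have "(\<lambda>n. - x * (c n * (x * p) ^ n)) sums (- x * \<phi> (x * p))"
      unfolding \<phi>_def by (intro sums_mult summable_sums sm xp)
    ultimately have "\<phi> x - \<phi> (x * p) = - x * \<phi> (x * p)"
      by (rule sums_unique2)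
    then show ?thesis
      by (simp add: algebra_simps)
  qed
  have iter: "\<phi> a = qpoch a p n * \<phi> (a * p ^ n)" for n
  proof (induction n)
    case (Suc n)
    show ?case
      using Suc fe[OF norm_mult_power_less_1[OF a p, of n]] by (simp add: qpoch_Suc mult_ac)
  qed simp
  have "isCont \<phi> 0"
    \<comment> \<open>Convergence at the point 1/2 gives continuity in the disc of that radius,
      which contains 0.\<close>
    unfolding \<phi>_def by (rule isCont_powser[OF sm[of "1/2"]]) (simp_all add: norm_divide)
  moreover have "(\<lambda>n. a * p ^ n) \<longlonglongrightarrow> 0"
    using tendsto_mult[OF tendsto_const LIMSEQ_power_zero[OF p], of a] by simp
  ultimately have "(\<lambda>n. \<phi> (a * p ^ n)) \<longlonglongrightarrow> \<phi> 0"
    by (rule isCont_tendsto_compose)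
  moreover have "\<phi> 0 = 1"
    unfolding \<phi>_def powser_zero by (simp add: c_def binomial_eq_0)
  ultimately have "(\<lambda>n. qpoch a p n * \<phi> (a * p ^ n)) \<longlonglongrightarrow> qpoch_inf a p * 1"
    by (intro tendsto_mult qpoch_tendsto p) simp
  then have "\<phi> a = qpoch_inf a p"
    using LIMSEQ_unique[OF tendsto_const] by (simp flip: iter)
  moreover have "((\<lambda>n. (- a) ^ n * p ^ (n choose 2) / qpoch p p n) has_sum \<phi> a) UNIV"
    unfolding \<phi>_def term_eq
    using euler_abs_summable[OF a p, unfolded term_eq]
    by (intro norm_summable_imp_has_sum summable_sums sm a) (rule summable_on_imp_summable)
  ultimately show ?thesis by simp
qed

section \<open>Formal power series under the dilation X \<mapsto> cX\<close>

unbundle no vec_syntax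
unbundle fps_syntax

definition fps_dilate :: "'a::comm_semiring_1 \<Rightarrow> 'a fps \<Rightarrow> 'a fps" where
  "fps_dilate c f = Abs_fps (\<lambda>n. c ^ n * f $ n)"

lemma fps_dilate_nth [simp]: "fps_dilate c f $ n = c ^ n * f $ n"
  by (simp add: fps_dilate_def)

lemma fps_dilate_mult: "fps_dilate c (f * g) = fps_dilate c f * fps_dilate c g"
  by (rule fps_ext)
    (auto simp: fps_mult_nth sum_distrib_left mult_ac simp flip: power_add intro!: sum.cong)

lemma fps_dilate_diff: "fps_dilate c (f - g) = fps_dilate c f - fps_dilate c g" for f g :: "'a::comm_ring_1 fps"
  by (rule fps_ext) (simp add: algebra_simps)

lemma fps_dilate_dilate: "fps_dilate c (fps_dilate d f) = fps_dilate (c * d) f"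
  by (rule fps_ext) (simp add: power_mult_distrib mult_ac)

lemma fps_dilate_linear:
  "fps_dilate c (1 - fps_const a * fps_X) = 1 - fps_const (a * c) * fps_X" for a :: "'a::comm_ring_1"
  by (rule fps_ext) (auto simp: fps_X_def)

lemma fps_linear_mult_nth_Suc:
  "((1 - fps_const a * fps_X) * f) $ Suc n = f $ Suc n - a * f $ n" for a :: "'a::comm_ring_1"
  by (simp add: left_diff_distrib mult.assoc)

lemma fps_linear_mult_nth_0: "((1 - fps_const a * fps_X) * f) $ 0 = f $ 0" for a :: "'a::comm_ring_1"
  by simp

text \<open>The difference h of two solutions solves the same equation. If its coefficients below n
  > 0 vanish, comparing coefficients at n gives h_n = p^n h_n, hence h_n = 0.\<close>

lemma fps_functional_equation_unique:
  fixes f g A B :: "'a::field fps"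
  assumes f: "A * f = B * fps_dilate p f" and g: "A * g = B * fps_dilate p g"
    and init: "f $ 0 = g $ 0" "A $ 0 = 1" "B $ 0 = 1"
    and p: "\<And>n. n > 0 \<Longrightarrow> p ^ n \<noteq> 1"
  shows "f = g"
proof (rule fps_ext)
  fix n show "f $ n = g $ n"
  proof (induction n rule: less_induct)
    case (less n)
    define h where "h = f - g"
    have h: "A * h = B * fps_dilate p h"
      using f g unfolding h_def by (simp add: right_diff_distrib fps_dilate_diff)
    have low: "h $ m = 0" if "m < n" for m
      using less[OF that] by (simp add: h_def)
    \<comment> \<open>When k starts in degree n or later, only the constant term of C reaches degree
      n.\<close>
    have leading: "(C * k) $ n = C $ 0 * k $ n" if "\<And>m. m < n \<Longrightarrow> k $ m = 0" for C k :: "'a fps"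
    proof -
      have "(C * k) $ n = (\<Sum>i\<in>{0..n}. if i = 0 then C $ 0 * k $ n else 0)"
        unfolding fps_mult_nth using that by (intro sum.cong) auto
      then show ?thesis by simp
    qed
    have "h $ n = p ^ n * h $ n"
      using leading[of h A] leading[of "fps_dilate p h" B] low h init by simp
    moreover have "h $ 0 = 0"
      using init by (simp add: h_def)
    ultimately have "h $ n = 0"
      using p[of n] by (cases "n = 0") auto
    then show ?case by (simp add: h_def)
  qed
qed

section \<open>Euler's two series as formal power series\<close>

text \<open>The expansion of (aX; p)_\<infinity>.\<close>

definition euler_num :: "complex \<Rightarrow> complex \<Rightarrow> complex fps" where
  "euler_num a p = Abs_fps (\<lambda>n. (- a) ^ n * p ^ (n choose 2) / qpoch p p n)"

text \<open>The expansion of 1 / (aX; p)_\<infinity>.\<close>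

definition euler_den :: "complex \<Rightarrow> complex \<Rightarrow> complex fps" where
  "euler_den a p = Abs_fps (\<lambda>n. a ^ n / qpoch p p n)"

lemma euler_num_nth: "euler_num a p $ n = (- a) ^ n * p ^ (n choose 2) / qpoch p p n"
  by (simp add: euler_num_def)

lemma euler_den_nth: "euler_den a p $ n = a ^ n / qpoch p p n"
  by (simp add: euler_den_def)

lemma euler_nth_0 [simp]: "euler_num a p $ 0 = 1" "euler_den a p $ 0 = 1"
  by (simp_all add: euler_num_nth euler_den_nth binomial_eq_0)

lemma euler_num_dilate:
  assumes "norm p < 1"
  shows "euler_num a p = (1 - fps_const a * fps_X) * fps_dilate p (euler_num a p)"
proof (rule fps_ext)
  fix n show "euler_num a p $ n = ((1 - fps_const a * fps_X) * fps_dilate p (euler_num a p)) $ n"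
  proof (cases n)
    case (Suc m)
    have "1 - p * p ^ m \<noteq> 0" "qpoch p p m \<noteq> 0"
      using one_minus_nonzero[OF norm_mult_power_less_1] qpoch_nonzero assms by auto
    then show ?thesis
      unfolding Suc fps_linear_mult_nth_Suc fps_dilate_nth euler_num_nth
      by (simp add: qpoch_Suc Suc_choose_two power_add field_simps)
  qed simp
qed

lemma euler_den_dilate:
  assumes "norm p < 1"
  shows "(1 - fps_const a * fps_X) * euler_den a p = fps_dilate p (euler_den a p)"
proof (rule fps_ext)
  fix n show "((1 - fps_const a * fps_X) * euler_den a p) $ n = fps_dilate p (euler_den a p) $ n"
  proof (cases n)
    case (Suc m)
    have "1 - p * p ^ m \<noteq> 0" "qpoch p p m \<noteq> 0"
      using one_minus_nonzero[OF norm_mult_power_less_1] qpoch_nonzero assms by auto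
    then show ?thesis
      unfolding Suc fps_linear_mult_nth_Suc fps_dilate_nth euler_den_nth
      by (simp add: qpoch_Suc field_simps)
  qed simp
qed

text \<open>Two dilations by p. The step p^2 is common to the bases q and -q, so series in either
  base can be combined.\<close>

lemma euler_den_dilate2:
  assumes "norm p < 1"
  shows "(1 - fps_const a * fps_X) * (1 - fps_const (a * p) * fps_X) * euler_den a p
    = fps_dilate (p ^ 2) (euler_den a p)"
proof -
  have "fps_dilate (p ^ 2) (euler_den a p) = fps_dilate p (fps_dilate p (euler_den a p))"
    by (simp add: fps_dilate_dilate power2_eq_square)
  also have "\<dots> = fps_dilate p ((1 - fps_const a * fps_X) * euler_den a p)"
    by (simp only: euler_den_dilate[OF assms])
  also have "\<dots> = (1 - fps_const (a * p) * fps_X) * fps_dilate p (euler_den a p)"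
    by (simp only: fps_dilate_mult fps_dilate_linear)
  finally show ?thesis
    by (simp only: euler_den_dilate[OF assms, symmetric] mult_ac)
qed

section \<open>The coefficients \<sigma>_N and the quotient series built from them\<close>

text \<open>The expansion of (aX, bX; p^2)_\<infinity>, with squared base; its coefficients are the
  \<sigma>_N.\<close>

definition euler_pair :: "complex \<Rightarrow> complex \<Rightarrow> complex \<Rightarrow> complex fps" where
  "euler_pair a b p = euler_num a (p ^ 2) * euler_num b (p ^ 2)"

text \<open>A closed form for the expansion of $(aX, bX; p)_\infty / (abX^2/p;\, p^2)_\infty$.\<close>

definition theta_quotient :: "complex \<Rightarrow> complex \<Rightarrow> complex \<Rightarrow> complex fps" where
  "theta_quotient a b p = Abs_fps (\<lambda>n. qpoch (- p) p n / p ^ (n choose 2) * euler_pair a b p $ n)"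

lemma theta_quotient_nth: "theta_quotient a b p $ n = qpoch (- p) p n / p ^ (n choose 2) * euler_pair a b p $ n"
  by (simp add: theta_quotient_def)

lemma euler_pair_dilate:
  assumes "norm p < 1"
  shows "euler_pair a b p
    = (1 - fps_const a * fps_X) * ((1 - fps_const b * fps_X) * fps_dilate (p ^ 2) (euler_pair a b p))"
proof -
  note e = euler_num_dilate[OF norm_power_less_1[OF assms, of 2, simplified]]
  show ?thesis
    unfolding euler_pair_def fps_dilate_mult
    by (subst e[of a], subst e[of b]) (simp only: mult_ac)
qed

text \<open>Coefficientwise, both sides reduce to the three-term recurrence that
  \<open>euler_pair_dilate\<close> gives for \<open>euler_pair\<close>. The factor (-p; p)_n / p^(n
  choose 2) converts the step p^2 of that recurrence into the step p required here.\<close>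

lemma theta_quotient_dilate:
  assumes p: "p \<noteq> 0" "norm p < 1"
  shows "(1 - fps_const (a * b / p) * fps_X ^ 2) * theta_quotient a b p
    = (1 - fps_const a * fps_X) * ((1 - fps_const b * fps_X) * fps_dilate p (theta_quotient a b p))"
    (is "?L = ?R")
proof (rule fps_ext)
  fix n
  define s where "s = (\<lambda>n. euler_pair a b p $ n)"
  have "euler_pair a b p $ Suc (Suc m) =
      ((1 - fps_const a * fps_X) * ((1 - fps_const b * fps_X) * fps_dilate (p ^ 2) (euler_pair a b p))) $ Suc (Suc m)" for m
    using euler_pair_dilate[OF p(2), of a b] by simp
  then have s2: "s (Suc (Suc m)) * (1 - p ^ (2 * m + 4)) =
      - (a + b) * p ^ (2 * m + 2) * s (Suc m) + a * b * p ^ (2 * m) * s m" for m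
    unfolding s_def fps_linear_mult_nth_Suc fps_dilate_nth
    by (simp add: algebra_simps power_add power_mult[symmetric] power2_eq_square numeral_eq_Suc)
  have "euler_pair a b p $ Suc 0 =
      ((1 - fps_const a * fps_X) * ((1 - fps_const b * fps_X) * fps_dilate (p ^ 2) (euler_pair a b p))) $ Suc 0"
    using euler_pair_dilate[OF p(2), of a b] by simp
  then have s1: "s 1 * (1 - p ^ 2) = - (a + b) * s 0"
    unfolding s_def fps_linear_mult_nth_Suc fps_linear_mult_nth_0 fps_dilate_nth
    by (simp add: algebra_simps)
  have sq: "fps_X ^ 2 * f = fps_X * (fps_X * f)" for f :: "complex fps"
    by (simp add: power2_eq_square mult_ac)
  show "?L $ n = ?R $ n"
  proof (cases n)
    case 0
    then show ?thesis by simp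
  next
    case (Suc k)
    show ?thesis
    proof (cases k)
      \<comment> \<open>In degree 1 the recurrence has only two terms, so \<open>s1\<close> takes
        the place of \<open>s2\<close>.\<close>
      case 0
      have "?L $ 1 = (1 + p) * s 1"
        by (simp add: left_diff_distrib mult.assoc sq theta_quotient_nth s_def qpoch_def binomial_eq_0)
      moreover have "?R $ 1 = p * ((1 + p) * s 1) - (a + b) * s 0"
        using fps_linear_mult_nth_Suc[where n = 0]
        by (simp add: fps_linear_mult_nth_0 theta_quotient_nth s_def qpoch_def binomial_eq_0 algebra_simps)
      moreover have "(1 + p) * s 1 - (p * ((1 + p) * s 1)) = s 1 * (1 - p ^ 2)"
        by (simp add: algebra_simps power2_eq_square)
      ultimately show ?thesis
        using s1 Suc 0 by (simp add: algebra_simps)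
    next
      case k: (Suc m)
      \<comment> \<open>With D, P and x the three consecutive coefficients of
        \<open>theta_quotient\<close> become rational expressions times values of
        \<open>s\<close>.\<close>
      define D where "D = qpoch (- p) p m"
      define P where "P = p ^ (m choose 2)"
      define x where "x = p ^ m"
      have nz: "P \<noteq> 0" "x \<noteq> 0"
        using p by (auto simp: P_def x_def)
      have t0: "theta_quotient a b p $ m = D / P * s m"
        by (simp add: theta_quotient_nth D_def P_def s_def)
      have t1: "theta_quotient a b p $ Suc m = D * (1 + p * x) / (P * x) * s (Suc m)"
        by (simp add: theta_quotient_nth D_def P_def s_def x_def qpoch_Suc Suc_choose_two power_add)
      have t2: "theta_quotient a b p $ Suc (Suc m)
          = D * (1 + p * x) * (1 + p ^ 2 * x) / (P * x * x * p) * s (Suc (Suc m))"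
        by (simp add: theta_quotient_nth D_def P_def s_def x_def qpoch_Suc Suc_choose_two power_add
            power2_eq_square mult_ac)
      have s2': "s (Suc (Suc m)) * (1 - p ^ 4 * x ^ 2) =
          - (a + b) * p ^ 2 * x ^ 2 * s (Suc m) + a * b * x ^ 2 * s m"
      proof -
        have "p ^ (2 * m) = x ^ 2" "p ^ (2 * m + 2) = p ^ 2 * x ^ 2" "p ^ (2 * m + 4) = p ^ 4 * x ^ 2"
          by (simp_all add: x_def power_mult power_add power2_eq_square power_mult_distrib mult_ac)
        then show ?thesis
          using s2[of m] by (simp only: mult.assoc)
      qed
      have L: "?L $ Suc (Suc m) = theta_quotient a b p $ Suc (Suc m) - a * b / p * theta_quotient a b p $ m"
        by (simp add: left_diff_distrib mult.assoc sq)
      have R: "?R $ Suc (Suc m) = p ^ 2 * x * theta_quotient a b p $ Suc (Suc m)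
          - (a + b) * p * x * theta_quotient a b p $ Suc m + a * b * x * theta_quotient a b p $ m"
        unfolding fps_linear_mult_nth_Suc fps_dilate_nth
        by (simp add: x_def algebra_simps power2_eq_square)
      have "(1 - p ^ 2 * x) * theta_quotient a b p $ Suc (Suc m)
          = - (a + b) * p * x * theta_quotient a b p $ Suc m + (a * b * x + a * b / p) * theta_quotient a b p $ m"
      proof -
        have "(1 - p ^ 2 * x) * theta_quotient a b p $ Suc (Suc m)
            = D * (1 + p * x) / (P * x * x * p) * (s (Suc (Suc m)) * (1 - p ^ 4 * x ^ 2))"
        \<comment> \<open>The factor 1 + p^2 x, the last one in (-p; p)_(m+2), completes 1 - p^2 x
          to the coefficient 1 - p^4 x^2 of the recurrence \<open>s2'\<close>.\<close>
        proof -
          have "1 - p ^ 4 * x ^ 2 = (1 - p ^ 2 * x) * (1 + p ^ 2 * x)"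
            by algebra
          then show ?thesis
            unfolding t2 by (simp only: times_divide_eq_left times_divide_eq_right mult_ac)
        qed
        also have "\<dots> = - (a + b) * p * x * (D * (1 + p * x) / (P * x) * s (Suc m))
            + (a * b * x + a * b / p) * (D / P * s m)"
          unfolding s2' using nz p by (simp add: field_simps power2_eq_square)
        finally show ?thesis
          unfolding t0 t1 .
      qed
      then show ?thesis
        unfolding Suc k L R by (simp add: algebra_simps)
    qed
  qed
qed

section \<open>Unordered sums over products and their grouping by degree\<close>

text \<open>Supplies the majorants for absolute convergence of the double and triple sums.\<close>

lemma summable_on_product_nonneg:
  fixes f :: "'a \<Rightarrow> real" and g :: "'b \<Rightarrow> real"
  assumes "f summable_on UNIV" "g summable_on UNIV" "\<And>x. f x \<ge> 0" "\<And>y. g y \<ge> 0"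
  shows "(\<lambda>(x, y). f x * g y) summable_on UNIV"
proof -
  have "(\<lambda>(x, y). f x * g y) summable_on UNIV \<times> UNIV"
  proof (rule summable_on_SigmaI)
    show "((\<lambda>y. case (x, y) of (x, y) \<Rightarrow> f x * g y) has_sum f x * infsum g UNIV) UNIV" for x
      using has_sum_cmult_right[OF has_sum_infsum[OF assms(2)], of "f x"] by simp
    show "(\<lambda>x. f x * infsum g UNIV) summable_on UNIV"
      by (intro summable_on_cmult_left assms)
  qed (use assms in auto)
  then show ?thesis by simp
qed

text \<open>Reindexing by x \<mapsto> (d x, x) turns the sum into an iterated one over the finite
  fibres of d.\<close>

lemma has_sum_by_degree:
  fixes f :: "'a \<Rightarrow> 'b :: {topological_comm_monoid_add, t3_space}" and d :: "'a \<Rightarrow> 'c"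
  assumes f: "(f has_sum S) UNIV" and fin: "\<And>n. finite {x. d x = n}"
  shows "((\<lambda>n. \<Sum>x | d x = n. f x) has_sum S) UNIV"
proof (rule has_sum_SigmaD)
  have "bij_betw (\<lambda>x. (d x, x)) UNIV (Sigma UNIV (\<lambda>n. {x. d x = n}))"
    by (auto simp: bij_betw_def inj_on_def)
  from has_sum_reindex_bij_betw[OF this, of "\<lambda>(n, x). f x" S]
  show "((\<lambda>(n, x). f x) has_sum S) (Sigma UNIV (\<lambda>n. {x. d x = n}))"
    using f by simp
  show "((\<lambda>x. case (n, x) of (n, x) \<Rightarrow> f x) has_sum (\<Sum>x | d x = n. f x)) {x. d x = n}" for n
    using has_sum_finite[OF fin] by simp
qed

text \<open>Convergence after grouping does not imply convergence before it, hence the summability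
  hypothesis. Given that, \<open>has_sum_by_degree\<close> and uniqueness of sums identify the
  value.\<close>

lemma has_sum_of_degree_sums:
  fixes f :: "'a \<Rightarrow> 'b :: {topological_comm_monoid_add, t3_space}" and d :: "'a \<Rightarrow> 'c"
  assumes f: "f summable_on UNIV" and fin: "\<And>n. finite {x. d x = n}"
    and S: "((\<lambda>n. \<Sum>x | d x = n. f x) has_sum S) UNIV"
  shows "(f has_sum S) UNIV"
  using has_sum_by_degree[OF has_sum_infsum[OF f] fin] S has_sum_infsum[OF f] has_sum_unique
  by blast

lemma fps_mult_nth_pairs: "(f * g) $ n = (\<Sum>(i, j) | i + j = n. f $ i * g $ j)"
  unfolding fps_mult_nth
  by (rule sum.reindex_bij_witness[where i = "\<lambda>(i, j). i" and j = "\<lambda>i. (i, n - i)"]) auto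

text \<open>The series \<open>h oo fps_X ^ k\<close> lives in degrees divisible by k, where the
  coefficient in degree k m is \<open>h $ m\<close>.\<close>

lemma fps_mult_compose_nth_triples:
  fixes f g h :: "'a::comm_ring_1 fps"
  assumes "k > 0"
  shows "(f * g * (h oo fps_X ^ k)) $ n = (\<Sum>(i, j, m) | i + j + k * m = n. f $ i * g $ j * h $ m)"
proof -
  have "(f * g * (h oo fps_X ^ k)) $ n
      = (\<Sum>l\<le>n. \<Sum>i\<le>l. f $ i * g $ (l - i) * (h oo fps_X ^ k) $ (n - l))"
    by (simp add: fps_mult_nth sum_distrib_right atLeast0AtMost)
  also have "\<dots> = (\<Sum>(l, i)\<in>Sigma {..n} (\<lambda>l. {..l}). f $ i * g $ (l - i) * (h oo fps_X ^ k) $ (n - l))"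
    by (subst sum.Sigma) auto
  also have "\<dots> = (\<Sum>(l, i) | l \<le> n \<and> i \<le> l \<and> k dvd n - l. f $ i * g $ (l - i) * h $ ((n - l) div k))"
    using assms by (intro sum.mono_neutral_cong_right) (auto simp: fps_nth_compose_X_power split: if_splits)
  also have "\<dots> = (\<Sum>(i, j, m) | i + j + k * m = n. f $ i * g $ j * h $ m)"
    \<comment> \<open>Here l = i + j is the degree taken up by the first two series, and m = (n - l)
      div k.\<close>
    by (rule sum.reindex_bij_witness[where
        i = "\<lambda>(i, j, m). (i + j, i)" and j = "\<lambda>(l, i). (i, l - i, (n - l) div k)"])
      (use assms in auto)
  finally show ?thesis .
qed

section \<open>Evaluation of the weighted coefficient sum\<close>

text \<open>This evaluates \<open>euler_pair\<close> at X = 1, as the Cauchy product of two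
  absolutely convergent Euler series.\<close>

lemma euler_pair_has_sum:
  assumes "norm a < 1" "norm b < 1" "norm p < 1"
  shows "(\<lambda>n. norm (euler_pair a b p $ n)) summable_on UNIV"
    and "((\<lambda>n. euler_pair a b p $ n) has_sum (qpoch_inf a (p ^ 2) * qpoch_inf b (p ^ 2))) UNIV"
proof -
  have p2: "norm (p ^ 2) < 1"
    using norm_power_less_1[OF assms(3), of 2] by simp
  define A where "A = (\<lambda>n. euler_num a (p ^ 2) $ n)"
  define B where "B = (\<lambda>n. euler_num b (p ^ 2) $ n)"
  have A: "(\<lambda>n. norm (A n)) summable_on UNIV" "(A has_sum qpoch_inf a (p ^ 2)) UNIV"
    and B: "(\<lambda>n. norm (B n)) summable_on UNIV" "(B has_sum qpoch_inf b (p ^ 2)) UNIV"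
    using euler_abs_summable[OF _ p2] euler_has_sum[OF _ p2] assms
    by (simp_all add: A_def B_def euler_num_nth)
  have AB: "(\<lambda>(i, j). norm (A i) * norm (B j)) summable_on UNIV"
    by (intro summable_on_product_nonneg A B) auto
  then have "(\<lambda>x. norm (case x of (i, j) \<Rightarrow> A i * B j)) summable_on UNIV"
    by (simp add: norm_mult case_prod_unfold)
  then have sm: "(\<lambda>(i, j). A i * B j) summable_on UNIV"
    by (rule abs_summable_summable)
  have fin: "finite {x. fst x + snd x = n}" for n :: nat
    by (rule finite_subset[of _ "{..n} \<times> {..n}"]) auto
  have "((\<lambda>(i, j). A i * B j) has_sum (qpoch_inf a (p ^ 2) * qpoch_inf b (p ^ 2))) (UNIV \<times> UNIV)"
  proof (rule has_sum_SigmaI)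
    show "((\<lambda>j. case (i, j) of (i, j) \<Rightarrow> A i * B j) has_sum A i * qpoch_inf b (p ^ 2)) UNIV" for i
      using has_sum_cmult_right[OF B(2), of "A i"] by simp
    show "((\<lambda>i. A i * qpoch_inf b (p ^ 2)) has_sum qpoch_inf a (p ^ 2) * qpoch_inf b (p ^ 2)) UNIV"
      by (rule has_sum_cmult_left[OF A(2)])
  qed (use sm in simp)
  then have "((\<lambda>n. \<Sum>x | fst x + snd x = n. case x of (i, j) \<Rightarrow> A i * B j)
      has_sum (qpoch_inf a (p ^ 2) * qpoch_inf b (p ^ 2))) UNIV"
    by (intro has_sum_by_degree fin) simp
  then show "((\<lambda>n. euler_pair a b p $ n) has_sum (qpoch_inf a (p ^ 2) * qpoch_inf b (p ^ 2))) UNIV"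
    by (simp add: euler_pair_def fps_mult_nth_pairs A_def B_def case_prod_unfold)
  have "(\<lambda>n. \<Sum>x | fst x + snd x = n. case x of (i, j) \<Rightarrow> norm (A i) * norm (B j)) summable_on UNIV"
    using has_sum_by_degree[OF has_sum_infsum[OF AB] fin] unfolding summable_on_def by blast
  moreover have "norm (euler_pair a b p $ n)
      \<le> (\<Sum>x | fst x + snd x = n. case x of (i, j) \<Rightarrow> norm (A i) * norm (B j))" for n
    unfolding euler_pair_def fps_mult_nth_pairs
    by (rule order_trans[OF norm_sum])
      (simp add: A_def B_def case_prod_unfold norm_mult)
  ultimately show "(\<lambda>n. norm (euler_pair a b p $ n)) summable_on UNIV"
    by (rule Infinite_Sum.abs_summable_on_comparison_test')
qed

text \<open>Uniqueness gives F = \<open>theta_quotient a b p * euler_den p p\<close>. The weight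
  splits by (N + c) choose 2 = (N choose 2) + (c choose 2) + N c, and its first part cancels the
  denominator in \<open>theta_quotient\<close>. For fixed N the sum over c is Euler's series for
  (-p^(N+1); p)_\<infinity>; the remaining sum over N is \<open>euler_pair\<close> at X = 1.\<close>

lemma has_sum_coeffs_of_functional_equation:
  fixes F :: "complex fps"
  assumes p: "p \<noteq> 0" "norm p < 1" and ab: "norm a < 1" "norm b < 1"
    and F0: "F $ 0 = 1"
    and F: "(1 - fps_const p * fps_X) * (1 - fps_const (a * b / p) * fps_X ^ 2) * F
      = (1 - fps_const a * fps_X) * (1 - fps_const b * fps_X) * fps_dilate p F"
  shows "((\<lambda>n. p ^ (n choose 2) * F $ n) has_sum
    (qpoch_inf a (p ^ 2) * qpoch_inf b (p ^ 2) / qpoch_inf p (p ^ 2))) UNIV"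
proof -
  define S where "S = qpoch_inf a (p ^ 2) * qpoch_inf b (p ^ 2)"
  have pn: "p ^ n \<noteq> 1" if "n > 0" for n
    using norm_power_less_1[OF p(2) that] by auto
  have F_eq: "F = theta_quotient a b p * euler_den p p"
  proof (rule fps_functional_equation_unique[OF F _ _ _ _ pn])
    \<comment> \<open>The equation for the product is the product of the equations for its two
      factors.\<close>
    show "(1 - fps_const p * fps_X) * (1 - fps_const (a * b / p) * fps_X ^ 2) * (theta_quotient a b p * euler_den p p)
      = (1 - fps_const a * fps_X) * (1 - fps_const b * fps_X) * fps_dilate p (theta_quotient a b p * euler_den p p)"
      unfolding fps_dilate_mult euler_den_dilate[OF p(2), symmetric]
      using theta_quotient_dilate[OF p, of a b] by algebra
    show "F $ 0 = (theta_quotient a b p * euler_den p p) $ 0"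
      using F0 by (simp add: theta_quotient_nth euler_pair_def binomial_eq_0)
  qed auto
  define G where "G = (\<lambda>(N, c). p ^ ((N + c) choose 2) * (theta_quotient a b p $ N * euler_den p p $ c))"
  \<comment> \<open>The double negation exhibits Euler's series at the argument -p^(N+1): one p
    comes from \<open>euler_den p p\<close>, the power p^N from the cross term N c.\<close>
  have G_eq: "G (N, c) = euler_pair a b p $ N * (qpoch (- p) p N
      * ((- (- (p * p ^ N))) ^ c * p ^ (c choose 2) / qpoch p p c))" for N c
    using p by (simp add: G_def theta_quotient_nth euler_den_nth add_choose_two power_add power_mult
        power_mult_distrib)
  obtain M where M: "M > 0" "\<And>n. norm (1 / qpoch p p n) \<le> M"
    using inverse_qpoch_bounded[OF p(2,2)] by blast
  obtain M' where M': "M' > 0" "\<And>n. norm (qpoch (- p) p n) \<le> M'"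
    using qpoch_bounded[OF p(2)] by blast
  \<comment> \<open>The geometric factor comes from \<open>euler_den p p\<close>; the other powers
    of p in \<open>G_eq\<close> are bounded by 1.\<close>
  have "(\<lambda>c. M' * M * norm p ^ c) summable_on UNIV"
    using p M M' by (subst summable_on_UNIV_nonneg_real_iff) (auto intro!: summable_mult summable_geometric)
  then have "(\<lambda>(N, c). norm (euler_pair a b p $ N) * (M' * M * norm p ^ c)) summable_on UNIV"
    using p M M' by (intro summable_on_product_nonneg euler_pair_has_sum ab) auto
  moreover have "norm (G x) \<le> (case x of (N, c) \<Rightarrow> norm (euler_pair a b p $ N) * (M' * M * norm p ^ c))" for x
  proof -
    obtain N c where x: "x = (N, c)" by (cases x)
    have "norm (G x) = norm (euler_pair a b p $ N) * (norm (qpoch (- p) p N)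
        * (norm (1 / qpoch p p c) * ((norm p ^ N) ^ c * norm p ^ (c choose 2) * norm p ^ c)))"
      by (simp add: x G_eq norm_mult norm_divide norm_power power_mult_distrib)
    also have "\<dots> \<le> norm (euler_pair a b p $ N) * (M' * (M * (1 * 1 * norm p ^ c)))"
      using p M M' by (intro mult_mono mult_right_mono power_le_one mult_nonneg_nonneg) auto
    finally show ?thesis by (simp add: x mult_ac)
  qed
  ultimately have "(\<lambda>x. norm (G x)) summable_on UNIV"
    by (rule Infinite_Sum.abs_summable_on_comparison_test')
  then have G_summable: "G summable_on UNIV"
    by (rule abs_summable_summable)
  have "(G has_sum qpoch_inf (- p) p * S) (UNIV \<times> UNIV)"
  proof (rule has_sum_SigmaI)
    show "((\<lambda>c. G (N, c)) has_sum qpoch_inf (- p) p * euler_pair a b p $ N) UNIV" for N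
    proof -
      have "norm (- (p * p ^ N)) < 1"
        using norm_mult_power_less_1[OF p(2,2), of N] by simp
      from has_sum_cmult_right[OF has_sum_cmult_right[OF euler_has_sum[OF this p(2)]],
          of "euler_pair a b p $ N" "qpoch (- p) p N"]
      show ?thesis
        unfolding G_eq using qpoch_inf_split[OF p(2), of "- p" N] by (simp add: mult_ac)
    qed
    show "((\<lambda>N. qpoch_inf (- p) p * euler_pair a b p $ N) has_sum qpoch_inf (- p) p * S) UNIV"
      unfolding S_def by (intro has_sum_cmult_right euler_pair_has_sum ab p)
  qed (use G_summable in simp)
  moreover have fin: "finite {x. fst x + snd x = n}" for n :: nat
    by (rule finite_subset[of _ "{..n} \<times> {..n}"]) auto
  ultimately have "((\<lambda>n. \<Sum>x | fst x + snd x = n. G x) has_sum qpoch_inf (- p) p * S) UNIV"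
    by (intro has_sum_by_degree) auto
  moreover have "(\<Sum>x | fst x + snd x = n. G x) = p ^ (n choose 2) * F $ n" for n
    unfolding F_eq fps_mult_nth_pairs sum_distrib_left
    by (intro sum.cong) (auto simp: G_def)
  moreover have "qpoch_inf (- p) p * S = S / qpoch_inf p (p ^ 2)"
  proof -
    have "qpoch_inf p (p ^ 2) \<noteq> 0"
      using qpoch_inf_nonzero p norm_power_less_1[OF p(2), of 2] by simp
    then show ?thesis
      using qpoch_inf_euler[OF p(2)] by (simp add: field_simps)
  qed
  ultimately show ?thesis
    unfolding S_def by simp
qed

section \<open>Infinite products at primitive cube roots of unity\<close>

text \<open>Together with (p; p^2)_\<infinity> the left side gives (p^3; p^6)_\<infinity>, which is
  also the middle third of (p; p^2)_\<infinity> and cancels.\<close>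

lemma qpoch_inf_omega_odd:
  assumes p: "norm p < 1" and w: "w + w' = -1" "w * w' = 1"
  shows "qpoch_inf (w * p) (p ^ 2) * qpoch_inf (w' * p) (p ^ 2)
    = 1 / (qpoch_inf p (p ^ 6) * qpoch_inf (p ^ 5) (p ^ 6))"
proof -
  note p2 = norm_power_less_1[OF p, of 2, simplified]
  have "qpoch_inf p (p ^ 2) * qpoch_inf (w * p) (p ^ 2) * qpoch_inf (w' * p) (p ^ 2) = qpoch_inf (p ^ 3) (p ^ 6)"
    using qpoch_inf_cube_roots[OF p2 w, of p] by (simp flip: power_mult)
  moreover have "qpoch_inf p (p ^ 2) = qpoch_inf p (p ^ 6) * qpoch_inf (p ^ 3) (p ^ 6) * qpoch_inf (p ^ 5) (p ^ 6)"
    using qpoch_inf_trisect[OF p2, of p]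
    by (simp flip: power_mult power_Suc power_add add: numeral_eq_Suc)
  moreover have "qpoch_inf (p ^ 3) (p ^ 6) \<noteq> 0"
    using p by (intro qpoch_inf_nonzero norm_power_less_1) auto
  ultimately have "(qpoch_inf p (p ^ 6) * qpoch_inf (p ^ 5) (p ^ 6)) * (qpoch_inf (w * p) (p ^ 2) * qpoch_inf (w' * p) (p ^ 2)) = 1"
    by (simp add: mult_ac)
  from inverse_unique[OF this] show ?thesis
    unfolding inverse_eq_divide by simp
qed

text \<open>The same argument with (p; p)_\<infinity>, whose part (p^3; p^3)_\<infinity>
  cancels.\<close>

lemma qpoch_inf_omega:
  assumes p: "norm p < 1" and w: "w + w' = -1" "w * w' = 1"
  shows "qpoch_inf (w * p) p * qpoch_inf (w' * p) p = 1 / (qpoch_inf p (p ^ 3) * qpoch_inf (p ^ 2) (p ^ 3))"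
proof -
  have "qpoch_inf p p * qpoch_inf (w * p) p * qpoch_inf (w' * p) p = qpoch_inf (p ^ 3) (p ^ 3)"
    using qpoch_inf_cube_roots[OF p w, of p] .
  moreover have "qpoch_inf p p = qpoch_inf p (p ^ 3) * qpoch_inf (p ^ 2) (p ^ 3) * qpoch_inf (p ^ 3) (p ^ 3)"
    using qpoch_inf_trisect[OF p, of p] by (simp add: numeral_eq_Suc)
  moreover have "qpoch_inf (p ^ 3) (p ^ 3) \<noteq> 0"
    using p by (intro qpoch_inf_nonzero norm_power_less_1) auto
  ultimately have "(qpoch_inf p (p ^ 3) * qpoch_inf (p ^ 2) (p ^ 3)) * (qpoch_inf (w * p) p * qpoch_inf (w' * p) p) = 1"
    by (simp add: mult_ac)
  from inverse_unique[OF this] show ?thesis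
    unfolding inverse_eq_divide by simp
qed

text \<open>The cube root identity at -p expresses the left side as (-p^3; p^3)_\<infinity> / (-p;
  p)_\<infinity>. Euler's theorem for p and p^3 turns this into (p; p^2)_\<infinity> / (p^3;
  p^6)_\<infinity>, and trisection finishes.\<close>

lemma qpoch_inf_minus_omega:
  assumes p: "norm p < 1" and w: "w + w' = -1" "w * w' = 1"
  shows "qpoch_inf (- (w * p)) p * qpoch_inf (- (w' * p)) p = qpoch_inf p (p ^ 6) * qpoch_inf (p ^ 5) (p ^ 6)"
proof -
  define A where "A = qpoch_inf (- (w * p)) p * qpoch_inf (- (w' * p)) p"
  define B where "B = qpoch_inf p (p ^ 6) * qpoch_inf (p ^ 5) (p ^ 6)"
  note p2 = norm_power_less_1[OF p, of 2, simplified] and p3 = norm_power_less_1[OF p, of 3, simplified]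
  have cubes: "qpoch_inf (- p) p * A = qpoch_inf (- (p ^ 3)) (p ^ 3)"
    using qpoch_inf_cube_roots[OF p w, of "- p"] by (simp add: A_def mult.assoc)
  have e1: "qpoch_inf (- p) p * qpoch_inf p (p ^ 2) = 1"
    by (rule qpoch_inf_euler[OF p])
  have e3: "qpoch_inf (- (p ^ 3)) (p ^ 3) * qpoch_inf (p ^ 3) (p ^ 6) = 1"
    using qpoch_inf_euler[OF p3] by (simp flip: power_mult)
  have tri: "qpoch_inf p (p ^ 2) = B * qpoch_inf (p ^ 3) (p ^ 6)"
    using qpoch_inf_trisect[OF p2, of p]
    by (simp flip: power_mult power_Suc power_add add: numeral_eq_Suc B_def)
  have "A = qpoch_inf (- p) p * A * qpoch_inf p (p ^ 2)"
    using e1 by algebra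
  also have "\<dots> = B * (qpoch_inf (- (p ^ 3)) (p ^ 3) * qpoch_inf (p ^ 3) (p ^ 6))"
    unfolding cubes tri by simp
  finally show ?thesis
    by (simp add: e3 A_def B_def)
qed

section \<open>The triple sums as weighted coefficient sums\<close>

lemma euler_den_bounded:
  assumes "norm p < 1"
  obtains M where "M > 0" "\<And>a n. norm (euler_den a p $ n) \<le> M * norm a ^ n"
proof -
  obtain M where M: "M > 0" "\<And>n. norm (1 / qpoch p p n) \<le> M"
    using inverse_qpoch_bounded[OF assms assms] by blast
  have "norm (euler_den a p $ n) \<le> M * norm a ^ n" for a n
  proof -
    have "norm (euler_den a p $ n) = norm (1 / qpoch p p n) * norm a ^ n"
      by (simp add: euler_den_nth norm_divide norm_power)
    then show ?thesis
      using M by (simp add: mult_right_mono)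
  qed
  with M show ?thesis using that by blast
qed

lemma euler_den_abs_summable:
  assumes "norm p < 1" "norm a < 1"
  shows "(\<lambda>n. norm (euler_den a p $ n)) summable_on UNIV"
proof -
  obtain M where M: "M > 0" "\<And>a n. norm (euler_den a p $ n) \<le> M * norm a ^ n"
    using euler_den_bounded[OF assms(1)] by blast
  have "(\<lambda>n. M * norm a ^ n) summable_on UNIV"
    using assms M by (subst summable_on_UNIV_nonneg_real_iff) (auto intro!: summable_mult summable_geometric)
  then show ?thesis
    using M(2) by (rule Infinite_Sum.abs_summable_on_comparison_test')
qed

text \<open>Under X \<mapsto> q^2 X each of the two denominators loses two linear factors and the
  cubic numerator loses one factor. The hypothesis on r admits both r = q and r = -q.\<close>

lemma triple_sum_functional_equation:
  fixes q r x y g :: complex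
  assumes q: "norm q < 1" and r: "r ^ 2 = q ^ 2"
  defines "F \<equiv> euler_den x q * euler_den y r * (euler_num g (q ^ 6) oo fps_X ^ 3)"
  shows "(1 - fps_const x * fps_X) * (1 - fps_const (x * q) * fps_X)
      * ((1 - fps_const y * fps_X) * (1 - fps_const (y * r) * fps_X)) * F
    = (1 - fps_const g * fps_X ^ 3) * fps_dilate (q ^ 2) F"
proof -
  have "norm r = norm q"
    using arg_cong[OF r, of norm] by (simp add: norm_power power2_eq_iff_nonneg)
  then have r1: "norm r < 1"
    using q by simp
  define h where "h = euler_num g (q ^ 6)"
  have "h oo fps_X ^ 3 = ((1 - fps_const g * fps_X) * fps_dilate (q ^ 6) h) oo fps_X ^ 3"
    using euler_num_dilate[OF norm_power_less_1[OF q, of 6], of g] by (simp flip: h_def)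
  also have "\<dots> = (1 - fps_const g * fps_X ^ 3) * (fps_dilate (q ^ 6) h oo fps_X ^ 3)"
    by (simp add: fps_compose_mult_distrib fps_compose_sub_distrib)
  \<comment> \<open>Scaling X by q^2 scales X^3 by q^6.\<close>
  also have "fps_dilate (q ^ 6) h oo fps_X ^ 3 = fps_dilate (q ^ 2) (h oo fps_X ^ 3)"
    by (rule fps_ext) (auto simp: fps_nth_compose_X_power simp flip: power_mult)
  finally have h: "h oo fps_X ^ 3 = (1 - fps_const g * fps_X ^ 3) * fps_dilate (q ^ 2) (h oo fps_X ^ 3)" .
  have x: "(1 - fps_const x * fps_X) * (1 - fps_const (x * q) * fps_X) * euler_den x q
      = fps_dilate (q ^ 2) (euler_den x q)"
    by (rule euler_den_dilate2[OF q])
  have y: "(1 - fps_const y * fps_X) * (1 - fps_const (y * r) * fps_X) * euler_den y r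
      = fps_dilate (q ^ 2) (euler_den y r)"
    using euler_den_dilate2[OF r1, of y] unfolding r .
  show ?thesis
    unfolding F_def fps_dilate_mult h_def[symmetric] x[symmetric] y[symmetric]
    by (subst h) (simp only: mult_ac)
qed

text \<open>The hypotheses \<open>left\<close> and \<open>right\<close> factor the two polynomials
  of \<open>triple_sum_functional_equation\<close> with a common factor C. Cancelling C leaves the
  equation of \<open>has_sum_coeffs_of_functional_equation\<close> for p = q^2, a = u, b =
  v.\<close>

lemma triple_sum_has_sum:
  fixes q r x y g u v :: complex and C :: "complex fps"
  assumes q: "q \<noteq> 0" "norm q < 1" and r: "r ^ 2 = q ^ 2"
    and xyg: "norm x < 1" "norm y < 1" "norm g < 1" and uv: "norm u < 1" "norm v < 1"
    and C: "C \<noteq> 0"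
    and left: "(1 - fps_const x * fps_X) * (1 - fps_const (x * q) * fps_X)
        * ((1 - fps_const y * fps_X) * (1 - fps_const (y * r) * fps_X))
      = C * ((1 - fps_const (q ^ 2) * fps_X) * (1 - fps_const (u * v / q ^ 2) * fps_X ^ 2))"
    and right: "1 - fps_const g * fps_X ^ 3 = C * ((1 - fps_const u * fps_X) * (1 - fps_const v * fps_X))"
  shows "((\<lambda>(i, j, k). (q ^ 2) ^ ((i + j + 3 * k) choose 2)
        * (x ^ i / qpoch q q i * (y ^ j / qpoch r r j)
          * ((- g) ^ k * (q ^ 6) ^ (k choose 2) / qpoch (q ^ 6) (q ^ 6) k)))
      has_sum (qpoch_inf u (q ^ 4) * qpoch_inf v (q ^ 4) / qpoch_inf (q ^ 2) (q ^ 4))) UNIV"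
    (is "(?f has_sum ?S) UNIV")
proof (rule has_sum_of_degree_sums[where d = "\<lambda>(i, j, k). i + j + 3 * k"])
  define F where "F = euler_den x q * euler_den y r * (euler_num g (q ^ 6) oo fps_X ^ 3)"
  have q2: "norm (q ^ 2) < 1" and q6: "norm (q ^ 6) < 1"
    using norm_power_less_1[OF q(2)] by simp_all
  have "norm r = norm q"
    using arg_cong[OF r, of norm] by (simp add: norm_power power2_eq_iff_nonneg)
  then have r1: "norm r < 1"
    using q by simp
  have f_eq: "?f (i, j, k) = (q ^ 2) ^ ((i + j + 3 * k) choose 2)
      * (euler_den x q $ i * euler_den y r $ j * euler_num g (q ^ 6) $ k)" for i j k
    by (simp add: euler_den_nth euler_num_nth)
  have "(\<lambda>(j, k). norm (euler_den y r $ j) * norm (euler_num g (q ^ 6) $ k)) summable_on UNIV"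
    using euler_abs_summable[OF xyg(3) q6] euler_den_abs_summable[OF r1 xyg(2)]
    by (intro summable_on_product_nonneg) (auto simp: euler_num_nth)
  then have "(\<lambda>(i, jk). norm (euler_den x q $ i)
      * (case jk of (j, k) \<Rightarrow> norm (euler_den y r $ j) * norm (euler_num g (q ^ 6) $ k))) summable_on UNIV"
    using euler_den_abs_summable[OF q(2) xyg(1)]
    by (intro summable_on_product_nonneg[where f = "\<lambda>i. norm (euler_den x q $ i)"]) auto
  moreover have "norm (?f t) \<le> (case t of (i, jk) \<Rightarrow> norm (euler_den x q $ i)
      * (case jk of (j, k) \<Rightarrow> norm (euler_den y r $ j) * norm (euler_num g (q ^ 6) $ k)))" for t
  proof -
    obtain i j k where t: "t = (i, j, k)" by (cases t)
    have "norm (?f t) = norm (q ^ 2) ^ ((i + j + 3 * k) choose 2)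
      * (norm (euler_den x q $ i) * (norm (euler_den y r $ j) * norm (euler_num g (q ^ 6) $ k)))"
      unfolding t f_eq by (simp add: norm_mult norm_power)
    also have "\<dots> \<le> 1 * (norm (euler_den x q $ i) * (norm (euler_den y r $ j) * norm (euler_num g (q ^ 6) $ k)))"
      using q2 by (intro mult_right_mono power_le_one) auto
    finally show ?thesis by (simp add: t)
  qed
  ultimately have "(\<lambda>t. norm (?f t)) summable_on UNIV"
    by (rule Infinite_Sum.abs_summable_on_comparison_test')
  then show "?f summable_on UNIV"
    by (rule abs_summable_summable)
  show "finite {t. (case t of (i, j, k) \<Rightarrow> i + j + 3 * k) = n}" for n :: nat
    by (rule finite_subset[of _ "{..n} \<times> {..n} \<times> {..n}"]) auto
  have "C * ((1 - fps_const (q ^ 2) * fps_X) * (1 - fps_const (u * v / q ^ 2) * fps_X ^ 2) * F)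
      = C * ((1 - fps_const u * fps_X) * (1 - fps_const v * fps_X) * fps_dilate (q ^ 2) F)"
    using triple_sum_functional_equation[OF q(2) r, of x y g]
    unfolding left right F_def[symmetric] by (simp only: mult.assoc)
  then have fe: "(1 - fps_const (q ^ 2) * fps_X) * (1 - fps_const (u * v / q ^ 2) * fps_X ^ 2) * F
      = (1 - fps_const u * fps_X) * (1 - fps_const v * fps_X) * fps_dilate (q ^ 2) F"
    using C by simp
  have "((\<lambda>n. (q ^ 2) ^ (n choose 2) * F $ n) has_sum
    (qpoch_inf u ((q ^ 2) ^ 2) * qpoch_inf v ((q ^ 2) ^ 2) / qpoch_inf (q ^ 2) ((q ^ 2) ^ 2))) UNIV"
    using q q2 by (intro has_sum_coeffs_of_functional_equation uv fe) (auto simp: F_def)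
  moreover have "(q ^ 2) ^ (n choose 2) * F $ n = (\<Sum>t | (case t of (i, j, k) \<Rightarrow> i + j + 3 * k) = n. ?f t)" for n
    unfolding F_def fps_mult_compose_nth_triples[OF zero_less_numeral] sum_distrib_left
    by (intro sum.cong) (auto simp: euler_den_nth euler_num_nth)
  ultimately show "((\<lambda>n. \<Sum>t | (case t of (i, j, k) \<Rightarrow> i + j + 3 * k) = n. ?f t) has_sum ?S) UNIV"
    by simp
qed

section \<open>The three identities\<close>

theorem theorem5p2:
  fixes q :: complex
  assumes "0 < norm q" and "norm q < 1"
  shows
    "((\<lambda>(i, j, k).
        (-1) ^ j * q ^ (2 * ((i + j + 3 * k) choose 2) + 6 * (k choose 2) + 2 * i + 3 * j + 12 * k)
        / (qpoch q q i * qpoch q q j * qpoch (q ^ 6) (q ^ 6) k))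
      has_sum (qpochs_inf [q ^ 4, q ^ 20] (q ^ 24) / qpoch_inf (q ^ 2) (q ^ 4)))
      (UNIV :: (nat \<times> nat \<times> nat) set)
    \<and>
     ((\<lambda>(i, j, k).
        (-1) ^ (j + k) * q ^ (2 * ((i + j + 3 * k) choose 2) + 6 * (k choose 2) + i + j + 6 * k)
        / (qpoch q q i * qpoch (-q) (-q) j * qpoch (q ^ 6) (q ^ 6) k))
      has_sum (1 / (qpoch_inf (q ^ 2) (q ^ 4) * qpochs_inf [q ^ 2, q ^ 10] (q ^ 12))))
      (UNIV :: (nat \<times> nat \<times> nat) set)
    \<and>
     ((\<lambda>(i, j, k).
        (-1) ^ (j + k) * q ^ (2 * ((i + j + 3 * k) choose 2) + 6 * (k choose 2) + 2 * i + 3 * j + 12 * k)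
        / (qpoch q q i * qpoch (-q) (-q) j * qpoch (q ^ 6) (q ^ 6) k))
      has_sum (1 / (qpoch_inf (q ^ 2) (q ^ 4) * qpochs_inf [q ^ 4, q ^ 8] (q ^ 12))))
      (UNIV :: (nat \<times> nat \<times> nat) set)"
proof (intro conjI)
  have q0: "q \<noteq> 0"
    using assms by auto
  note q = q0 assms(2)
  \<comment> \<open>A primitive cube root of unity; \<open>w'\<close> is the other one.\<close>
  define w where "w = Complex (- 1 / 2) (sqrt 3 / 2)"
  define w' where "w' = cnj w"
  have w: "w + w' = - 1" "w * w' = 1"
    by (simp_all add: w_def w'_def complex_eq_iff power2_eq_square[symmetric] power_divide)
  have "norm w = 1"
    by (simp add: w_def complex_norm power_divide)
  then have nw: "norm w = 1" "norm w' = 1"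
    by (simp_all add: w'_def)
  have less: "norm (q ^ n) < 1" if "n > 0" for n
    by (rule norm_power_less_1[OF q(2) that])
  have W: "fps_const w + fps_const w' = - 1" "fps_const w * fps_const w' = 1"
    using w by simp_all
  have nz: "1 + fps_const c * fps_X \<noteq> 0" for c :: complex
  proof
    assume "1 + fps_const c * fps_X = 0"
    then have "(1 + fps_const c * fps_X) $ 0 = 0 $ 0" by (rule arg_cong)
    then show False by simp
  qed
  have nz': "1 - fps_const c * fps_X \<noteq> 0" for c :: complex
    using nz[of "- c"] by (simp flip: fps_const_neg)
  \<comment> \<open>Splitting the constants turns the side conditions into polynomial identities in
    \<open>fps_const q\<close>, \<open>fps_const w\<close>, \<open>fps_const w'\<close> and
    \<open>fps_X\<close>.\<close>
  note push = fps_const_mult[symmetric] fps_const_power[symmetric] fps_const_neg[symmetric]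

  \<comment> \<open>The values of u v / q^2 in the three cases, computed beforehand to remove the
    divisions.\<close>
  have uv: "- (w * q ^ 4) * - (w' * q ^ 4) / q ^ 2 = q ^ 6" "w * q ^ 2 * (w' * q ^ 2) / q ^ 2 = q ^ 2"
    "w * q ^ 4 * (w' * q ^ 4) / q ^ 2 = q ^ 6"
  proof -
    have *: "- (w * q ^ 4) * - (w' * q ^ 4) = q ^ 6 * q ^ 2" "w * q ^ 2 * (w' * q ^ 2) = q ^ 2 * q ^ 2"
      "w * q ^ 4 * (w' * q ^ 4) = q ^ 6 * q ^ 2"
      using w(2) by algebra+
    show "- (w * q ^ 4) * - (w' * q ^ 4) / q ^ 2 = q ^ 6" "w * q ^ 2 * (w' * q ^ 2) / q ^ 2 = q ^ 2"
      "w * q ^ 4 * (w' * q ^ 4) / q ^ 2 = q ^ 6"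
      by (simp_all only: * nonzero_mult_div_cancel_right[OF power_not_zero[OF q0]])
  qed

  \<comment> \<open>First identity: x = q^2, y = -q^3, r = q, g = -q^12. Here 1 + q^12 X^3 has the
    factors 1 + q^4 X, 1 + w q^4 X and 1 + w' q^4 X; the first also divides the other polynomial and
    serves as C.\<close>
  have "((\<lambda>(i, j, k). (q ^ 2) ^ ((i + j + 3 * k) choose 2)
        * ((q ^ 2) ^ i / qpoch q q i * ((- (q ^ 3)) ^ j / qpoch q q j)
          * ((- (- (q ^ 12))) ^ k * (q ^ 6) ^ (k choose 2) / qpoch (q ^ 6) (q ^ 6) k)))
      has_sum (qpoch_inf (- (w * q ^ 4)) (q ^ 4) * qpoch_inf (- (w' * q ^ 4)) (q ^ 4) / qpoch_inf (q ^ 2) (q ^ 4))) UNIV"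
  proof (rule triple_sum_has_sum[where C = "1 + fps_const (q ^ 4) * fps_X"])
    show "(1 - fps_const (q ^ 2) * fps_X) * (1 - fps_const (q ^ 2 * q) * fps_X)
        * ((1 - fps_const (- (q ^ 3)) * fps_X) * (1 - fps_const (- (q ^ 3) * q) * fps_X))
      = (1 + fps_const (q ^ 4) * fps_X) * ((1 - fps_const (q ^ 2) * fps_X)
        * (1 - fps_const (- (w * q ^ 4) * - (w' * q ^ 4) / q ^ 2) * fps_X ^ 2))"
      unfolding uv push by algebra
    show "1 - fps_const (- (q ^ 12)) * fps_X ^ 3
      = (1 + fps_const (q ^ 4) * fps_X) * ((1 - fps_const (- (w * q ^ 4)) * fps_X) * (1 - fps_const (- (w' * q ^ 4)) * fps_X))"
      using W unfolding push by algebra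
  qed (use q less nz in \<open>simp_all add: norm_mult norm_power power_less_one_iff nw\<close>)
  moreover have "qpoch_inf (- (w * q ^ 4)) (q ^ 4) * qpoch_inf (- (w' * q ^ 4)) (q ^ 4)
      = qpochs_inf [q ^ 4, q ^ 20] (q ^ 24)"
    using qpoch_inf_minus_omega[OF less[of 4] w] by (simp add: qpochs_inf_def flip: power_mult)
  moreover have "(-1) ^ j * q ^ (2 * ((i + j + 3 * k) choose 2) + 6 * (k choose 2) + 2 * i + 3 * j + 12 * k)
        / (qpoch q q i * qpoch q q j * qpoch (q ^ 6) (q ^ 6) k) =
      (q ^ 2) ^ ((i + j + 3 * k) choose 2)
        * ((q ^ 2) ^ i / qpoch q q i * ((- (q ^ 3)) ^ j / qpoch q q j)
          * ((- (- (q ^ 12))) ^ k * (q ^ 6) ^ (k choose 2) / qpoch (q ^ 6) (q ^ 6) k))" for i j k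
    unfolding power_minus[of "q ^ 3"] by (simp add: power_add power_mult)
  ultimately show "((\<lambda>(i, j, k).
        (-1) ^ j * q ^ (2 * ((i + j + 3 * k) choose 2) + 6 * (k choose 2) + 2 * i + 3 * j + 12 * k)
        / (qpoch q q i * qpoch q q j * qpoch (q ^ 6) (q ^ 6) k))
      has_sum (qpochs_inf [q ^ 4, q ^ 20] (q ^ 24) / qpoch_inf (q ^ 2) (q ^ 4)))
      (UNIV :: (nat \<times> nat \<times> nat) set)"
    by (simp only:)

  \<comment> \<open>Second identity: x = q, y = r = -q, g = q^6. The polynomial on the left is (1 -
    q^2 X)^2 (1 - q^2 X^2), so C = 1 - q^2 X leaves one such factor.\<close>
  have "((\<lambda>(i, j, k). (q ^ 2) ^ ((i + j + 3 * k) choose 2)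
        * (q ^ i / qpoch q q i * ((- q) ^ j / qpoch (- q) (- q) j)
          * ((- (q ^ 6)) ^ k * (q ^ 6) ^ (k choose 2) / qpoch (q ^ 6) (q ^ 6) k)))
      has_sum (qpoch_inf (w * q ^ 2) (q ^ 4) * qpoch_inf (w' * q ^ 2) (q ^ 4) / qpoch_inf (q ^ 2) (q ^ 4))) UNIV"
  proof (rule triple_sum_has_sum[where C = "1 - fps_const (q ^ 2) * fps_X"])
    show "(1 - fps_const (q) * fps_X) * (1 - fps_const (q * q) * fps_X)
        * ((1 - fps_const (- q) * fps_X) * (1 - fps_const (- q * - q) * fps_X))
      = (1 - fps_const (q ^ 2) * fps_X) * ((1 - fps_const (q ^ 2) * fps_X)
        * (1 - fps_const (w * q ^ 2 * (w' * q ^ 2) / q ^ 2) * fps_X ^ 2))"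
      unfolding uv push by algebra
    show "1 - fps_const (q ^ 6) * fps_X ^ 3
      = (1 - fps_const (q ^ 2) * fps_X) * ((1 - fps_const (w * q ^ 2) * fps_X) * (1 - fps_const ((w' * q ^ 2)) * fps_X))"
      using W unfolding push by algebra
  qed (use q less nz' in \<open>simp_all add: norm_mult norm_power power_less_one_iff nw\<close>)
  moreover have "qpoch_inf (w * q ^ 2) (q ^ 4) * qpoch_inf (w' * q ^ 2) (q ^ 4) / qpoch_inf (q ^ 2) (q ^ 4)
      = 1 / (qpoch_inf (q ^ 2) (q ^ 4) * qpochs_inf [q ^ 2, q ^ 10] (q ^ 12))"
    using qpoch_inf_omega_odd[OF less[of 2] w] by (simp add: qpochs_inf_def mult_ac flip: power_mult)
  moreover have "(-1) ^ (j + k) * q ^ (2 * ((i + j + 3 * k) choose 2) + 6 * (k choose 2) + i + j + 6 * k)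
        / (qpoch q q i * qpoch (-q) (-q) j * qpoch (q ^ 6) (q ^ 6) k) =
      (q ^ 2) ^ ((i + j + 3 * k) choose 2)
        * (q ^ i / qpoch q q i * ((- q) ^ j / qpoch (- q) (- q) j)
          * ((- (q ^ 6)) ^ k * (q ^ 6) ^ (k choose 2) / qpoch (q ^ 6) (q ^ 6) k))" for i j k
    unfolding power_minus[of q] power_minus[of "q ^ 6"] by (simp add: power_add power_mult)
  ultimately show "((\<lambda>(i, j, k).
        (-1) ^ (j + k) * q ^ (2 * ((i + j + 3 * k) choose 2) + 6 * (k choose 2) + i + j + 6 * k)
        / (qpoch q q i * qpoch (-q) (-q) j * qpoch (q ^ 6) (q ^ 6) k))
      has_sum (1 / (qpoch_inf (q ^ 2) (q ^ 4) * qpochs_inf [q ^ 2, q ^ 10] (q ^ 12))))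
      (UNIV :: (nat \<times> nat \<times> nat) set)"
    by (simp only:)

  \<comment> \<open>Third identity: x = q^2, y = -q^3, r = -q, g = q^12. Compared with the first, y
    r = q^4 has the opposite sign, so C = 1 - q^4 X and the signs of u and v change.\<close>
  have "((\<lambda>(i, j, k). (q ^ 2) ^ ((i + j + 3 * k) choose 2)
        * ((q ^ 2) ^ i / qpoch q q i * ((- (q ^ 3)) ^ j / qpoch (- q) (- q) j)
          * ((- (q ^ 12)) ^ k * (q ^ 6) ^ (k choose 2) / qpoch (q ^ 6) (q ^ 6) k)))
      has_sum (qpoch_inf (w * q ^ 4) (q ^ 4) * qpoch_inf (w' * q ^ 4) (q ^ 4) / qpoch_inf (q ^ 2) (q ^ 4))) UNIV"
  proof (rule triple_sum_has_sum[where C = "1 - fps_const (q ^ 4) * fps_X"])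
    show "(1 - fps_const (q ^ 2) * fps_X) * (1 - fps_const (q ^ 2 * q) * fps_X)
        * ((1 - fps_const (- (q ^ 3)) * fps_X) * (1 - fps_const (- (q ^ 3) * - q) * fps_X))
      = (1 - fps_const (q ^ 4) * fps_X) * ((1 - fps_const (q ^ 2) * fps_X)
        * (1 - fps_const (w * q ^ 4 * (w' * q ^ 4) / q ^ 2) * fps_X ^ 2))"
      unfolding uv push by algebra
    show "1 - fps_const (q ^ 12) * fps_X ^ 3
      = (1 - fps_const (q ^ 4) * fps_X) * ((1 - fps_const (w * q ^ 4) * fps_X) * (1 - fps_const ((w' * q ^ 4)) * fps_X))"
      using W unfolding push by algebra
  qed (use q less nz' in \<open>simp_all add: norm_mult norm_power power_less_one_iff nw\<close>)
  moreover have "qpoch_inf (w * q ^ 4) (q ^ 4) * qpoch_inf (w' * q ^ 4) (q ^ 4) / qpoch_inf (q ^ 2) (q ^ 4)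
      = 1 / (qpoch_inf (q ^ 2) (q ^ 4) * qpochs_inf [q ^ 4, q ^ 8] (q ^ 12))"
    using qpoch_inf_omega[OF less[of 4] w] by (simp add: qpochs_inf_def mult_ac flip: power_mult)
  moreover have "(-1) ^ (j + k) * q ^ (2 * ((i + j + 3 * k) choose 2) + 6 * (k choose 2) + 2 * i + 3 * j + 12 * k)
        / (qpoch q q i * qpoch (-q) (-q) j * qpoch (q ^ 6) (q ^ 6) k) =
      (q ^ 2) ^ ((i + j + 3 * k) choose 2)
        * ((q ^ 2) ^ i / qpoch q q i * ((- (q ^ 3)) ^ j / qpoch (- q) (- q) j)
          * ((- (q ^ 12)) ^ k * (q ^ 6) ^ (k choose 2) / qpoch (q ^ 6) (q ^ 6) k))" for i j k
    unfolding power_minus[of "q ^ 3"] power_minus[of "q ^ 12"] by (simp add: power_add power_mult)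
  ultimately show "((\<lambda>(i, j, k).
        (-1) ^ (j + k) * q ^ (2 * ((i + j + 3 * k) choose 2) + 6 * (k choose 2) + 2 * i + 3 * j + 12 * k)
        / (qpoch q q i * qpoch (-q) (-q) j * qpoch (q ^ 6) (q ^ 6) k))
      has_sum (1 / (qpoch_inf (q ^ 2) (q ^ 4) * qpochs_inf [q ^ 4, q ^ 8] (q ^ 12))))
      (UNIV :: (nat \<times> nat \<times> nat) set)"
    by (simp only:)
qed

end
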